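(* Let $I=(0,1)$ and, for $(s,t)\in I^2\setminus\{s=t\}$, let $$K^+(s,t)=\frac{1}{2\sin\frac{\pi(s+t)}{2}},\qquad K^-(s,t)=\frac{1}{2\sin\frac{\pi|s-t|}{2}} .$$ There exist constants $C,d>0$ such that for every $(s,t)\in I^2\setminus\{s=t\}$ and for every $p,p'\in\mathbb N$, $$\left|D_s^pD_t^{p'}K^\pm(s,t)\right|\le C\,\frac{d^{\,p+p'}(p+p')!}{|s-t|^{p+p'+1}} .$$
   Context: $\mathbb N=\{1,2,\dots\}$. $D_s^p$ and $D_t^{p'}$ denote partial derivatives of order $p$ in $s$ and of order $p'$ in $t$. The estimate is asserted for both kernels $K^+$ and $K^-$. The constants $C,d$ do not depend on $s,t,p,p'$. *)

theory Defs
  imports "HOL-Analysis.Derivative"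
begin

text \<open>
  The kernels are given by their formulas on the whole plane; only their values on the open set
  \<open>{0<..<1} \<times> {0<..<1}\<close> minus the diagonal matter, since partial derivatives at a point of an
  open set depend only on the values near that point.
\<close>

definition K_plus :: "real \<Rightarrow> real \<Rightarrow> real" where
  "K_plus s t = 1 / (2 * sin (pi * (s + t) / 2))"

definition K_minus :: "real \<Rightarrow> real \<Rightarrow> real" where
  "K_minus s t = 1 / (2 * sin (pi * \<bar>s - t\<bar> / 2))"

definition D_s :: "(real \<Rightarrow> real \<Rightarrow> real) \<Rightarrow> real \<Rightarrow> real \<Rightarrow> real" where
  "D_s F = (\<lambda>s t. deriv (\<lambda>x. F x t) s)"

definition D_t :: "(real \<Rightarrow> real \<Rightarrow> real) \<Rightarrow> real \<Rightarrow> real \<Rightarrow> real" where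
  "D_t F = (\<lambda>s t. deriv (\<lambda>y. F s y) t)"

end

theory Submission
  imports Defs "HOL-Complex_Analysis.Cauchy_Integral_Formula"
begin

text \<open>
  Both kernels are one-variable functions in disguise: with \<open>g x = 1 / (2 * sin (pi * x / 2))\<close> they
  are \<open>g (s + t)\<close> and \<open>g \<bar>s - t\<bar>\<close>, and off the diagonal the argument is locally an affine form
  \<open>a * s + b * t\<close> with \<open>\<bar>a\<bar> = \<bar>b\<bar> = 1\<close>. A mixed derivative of order \<open>(p, p')\<close> is therefore, up to
  sign, the derivative of \<open>g\<close> of order \<open>p + p'\<close> (\<open>iterated_D_s_D_t_of_ridge\<close>).

  The growth of the derivatives of \<open>g\<close> is governed by the distance to its poles \<open>0\<close> and \<open>2\<close>. The
  complex extension of \<open>g\<close> is holomorphic in the strip \<open>0 < Re z < 2\<close>, and it is bounded by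
  \<open>1 / \<delta>\<close> on the disc of radius \<open>\<delta> / 2\<close> about a real point \<open>x\<close> whose distance to both poles is
  at least \<open>\<delta>\<close>, because there the modulus of the sine is at least the sine of the real part, which
  concavity bounds from below. Cauchy's inequality on this disc gives the bound
  \<open>2 ^ n * fact n / \<delta> ^ (n + 1)\<close> for the derivative of order \<open>n\<close>
  (\<open>norm_higher_deriv_half_csc_le\<close>).

  Finally, for \<open>s, t\<close> in the unit interval, both \<open>s + t\<close> and \<open>\<bar>s - t\<bar>\<close> have distance at
  least \<open>\<bar>s - t\<bar>\<close> from \<open>0\<close> and from \<open>2\<close>, so \<open>\<delta> = \<bar>s - t\<bar>\<close> is admissible and the theorem
  holds with \<open>C = 1\<close> and \<open>d = 2\<close>.
\<close>

section \<open>The half cosecant and its derivatives\<close>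

definition half_csc :: "complex \<Rightarrow> complex" where
  "half_csc z = 1 / (2 * sin (of_real pi * z / 2))"

text \<open>
  This is Jordan's inequality for the sine, reflected at \<open>pi / 2\<close>; on the left half it compares the
  concave sine with its chord.
\<close>

lemma sin_half_pi_ge:
  fixes \<delta> y :: real
  assumes "0 \<le> \<delta>" "\<delta> \<le> y" "\<delta> \<le> 2 - y"
  shows "\<delta> \<le> sin (pi * y / 2)"
proof -
  have concave: "concave_on {0..pi/2} sin"
  proof (rule f''_le0_imp_concave)
    show "DERIV sin x :> cos x" "DERIV cos x :> - sin x" for x :: real
      by (auto intro!: derivative_eq_intros)
    show "- sin x \<le> 0" if "x \<in> {0..pi/2}" for x :: real
      using that pi_gt_zero by (auto intro!: sin_ge_zero simp del: pi_gt_zero)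
  qed simp
  have chord: "u \<le> sin (pi * u / 2)" if "0 \<le> u" "u \<le> 1" for u :: real
    using concave_onD_Icc [OF concave _ that] by (simp add: mult.commute)
  show ?thesis
  proof (cases "y \<le> 1")
    case True
    then show ?thesis using chord [of y] assms by simp
  next
    case False
    have "sin (pi * (2 - y) / 2) = sin (pi - pi * y / 2)"
      by (simp add: algebra_simps diff_divide_distrib)
    also have "\<dots> = sin (pi * y / 2)" by simp
    finally show ?thesis using chord [of "2 - y"] False assms by simp
  qed
qed

lemma norm_sin_ge_sin_Re:
  assumes "0 \<le> sin (Re z)"
  shows "sin (Re z) \<le> norm (sin z)"
proof -
  have "1 \<le> (exp (Im z) + exp (- Im z)) / 2"
    using cosh_real_ge_1 [of "Im z"] by (simp add: cosh_field_def)
  then have "sin (Re z) * 1 \<le> sin (Re z) * ((exp (Im z) + exp (- Im z)) / 2)"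
    using assms by (rule mult_left_mono)
  also have "\<dots> = Re (sin z)" by (simp add: Re_sin)
  also have "\<dots> \<le> norm (sin z)" by (rule complex_Re_le_cmod)
  finally show ?thesis by simp
qed

lemma norm_sin_half_pi_ge:
  fixes z :: complex
  assumes "0 \<le> \<delta>" "\<delta> \<le> Re z" "\<delta> \<le> 2 - Re z"
  shows "\<delta> \<le> norm (sin (of_real pi * z / 2))"
  using sin_half_pi_ge [OF assms] norm_sin_ge_sin_Re [of "of_real pi * z / 2"] assms(1) by simp

lemma norm_half_csc_le:
  assumes "0 < \<delta>" "\<delta> \<le> Re z" "\<delta> \<le> 2 - Re z"
  shows "norm (half_csc z) \<le> 1 / (2 * \<delta>)"
  using norm_sin_half_pi_ge [of \<delta> z] assms
  by (simp add: half_csc_def norm_divide norm_mult frac_le)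

definition strip :: "complex set" where
  "strip = {z. 0 < Re z \<and> Re z < 2}"

lemma open_strip: "open strip"
  unfolding strip_def
  by (intro open_Collect_conj open_halfspace_Re_gt open_halfspace_Re_lt)

lemma holomorphic_half_csc: "half_csc holomorphic_on strip"
proof -
  have "sin (of_real pi * z / 2) \<noteq> 0" if "z \<in> strip" for z
    using norm_sin_half_pi_ge [of "min (Re z) (2 - Re z)" z] that by (auto simp: strip_def)
  then show ?thesis
    unfolding half_csc_def [abs_def] by (intro holomorphic_intros) auto
qed

text \<open>
  The radius \<open>\<delta> / 2\<close> leaves the distance \<open>\<delta> / 2\<close> between the disc and the poles, so that
  \<open>half_csc\<close> is bounded by \<open>1 / \<delta>\<close> on the bounding circle.
\<close>

lemma norm_higher_deriv_half_csc_le: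
  fixes x \<delta> :: real
  assumes "0 < \<delta>" "\<delta> \<le> x" "\<delta> \<le> 2 - x"
  shows "norm ((deriv ^^ n) half_csc (of_real x)) \<le> 2 ^ n * fact n / \<delta> ^ (n + 1)"
proof -
  have Re_near: "\<delta>/2 \<le> Re z \<and> \<delta>/2 \<le> 2 - Re z" if "norm (of_real x - z) \<le> \<delta>/2" for z
    using abs_Re_le_cmod [of "of_real x - z"] that assms by auto
  have sub: "cball (of_real x) (\<delta>/2) \<subseteq> strip"
  proof
    fix z :: complex
    assume "z \<in> cball (of_real x) (\<delta>/2)"
    then show "z \<in> strip" using Re_near [of z] assms(1) by (simp add: strip_def dist_norm)
  qed
  have "norm ((deriv ^^ n) half_csc (of_real x)) \<le> fact n * (1 / \<delta>) / (\<delta>/2) ^ n"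
  proof (rule Cauchy_inequality)
    show "half_csc holomorphic_on ball (of_real x) (\<delta>/2)"
      using holomorphic_half_csc order_trans [OF ball_subset_cball sub]
      by (rule holomorphic_on_subset)
    show "continuous_on (cball (of_real x) (\<delta>/2)) half_csc"
      using holomorphic_on_imp_continuous_on [OF holomorphic_half_csc] sub
      by (rule continuous_on_subset)
    show "norm (half_csc z) \<le> 1 / \<delta>" if "norm (of_real x - z) = \<delta>/2" for z
      using norm_half_csc_le [of "\<delta>/2" z] Re_near [of z] that assms by simp
  qed (use assms in simp)
  also have "\<dots> = 2 ^ n * fact n / \<delta> ^ (n + 1)"
    by (simp add: field_simps)
  finally show ?thesis .
qed

definition half_csc_deriv :: "nat \<Rightarrow> real \<Rightarrow> real" where
  "half_csc_deriv n x = Re ((deriv ^^ n) half_csc (of_real x))"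

lemma half_csc_deriv_0: "half_csc_deriv 0 x = 1 / (2 * sin (pi * x / 2))"
proof -
  have "half_csc (of_real x) = of_real (1 / (2 * sin (pi * x / 2)))"
    using sin_of_real [of "pi * x / 2", where 'a = complex] by (simp add: half_csc_def)
  then show ?thesis by (simp add: half_csc_deriv_def)
qed

lemma half_csc_deriv_has_derivative:
  assumes "x \<in> {0<..<2}"
  shows "(half_csc_deriv n has_real_derivative half_csc_deriv (Suc n) x) (at x)"
proof -
  have "of_real x \<in> strip" using assms by (simp add: strip_def)
  then have "((deriv ^^ n) half_csc has_field_derivative (deriv ^^ Suc n) half_csc (of_real x))
      (at (of_real x))"
    by (rule has_field_derivative_higher_deriv [OF holomorphic_half_csc open_strip])
  then show ?thesis
    unfolding half_csc_deriv_def [abs_def]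
    by (intro has_field_derivative_Re has_vector_derivative_real_field)
qed

lemma abs_half_csc_deriv_le:
  assumes "0 < \<delta>" "\<delta> \<le> x" "\<delta> \<le> 2 - x"
  shows "\<bar>half_csc_deriv n x\<bar> \<le> 2 ^ n * fact n / \<delta> ^ (n + 1)"
  unfolding half_csc_deriv_def
  using abs_Re_le_cmod norm_higher_deriv_half_csc_le [OF assms] by (rule order_trans)

section \<open>Mixed derivatives of a function of an affine form\<close>

text \<open>
  Assuming the representation \<open>h y = k * G (a * y + c)\<close> only where the affine form takes values
  in \<open>S\<close> makes the statement local. This is what lets the absolute value in
  \<open>K_minus\<close> be resolved differently on the two sides of the diagonal. Openness of \<open>S\<close> keeps the
  representation valid near the point at which a derivative is taken.
\<close>

lemma deriv_of_ridge:
  fixes G G' h :: "real \<Rightarrow> real"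
  assumes "open S"
    and G: "\<And>x. x \<in> S \<Longrightarrow> (G has_real_derivative G' x) (at x)"
    and h: "\<And>y. a * y + c \<in> S \<Longrightarrow> h y = k * G (a * y + c)"
    and "a * x + c \<in> S"
  shows "deriv h x = a * k * G' (a * x + c)"
proof (rule DERIV_imp_deriv)
  let ?U = "(\<lambda>y. a * y + c) -` S"
  have "((\<lambda>y. k * G (a * y + c)) has_real_derivative k * (G' (a * x + c) * a)) (at x)"
    by (intro DERIV_cmult DERIV_chain2 [where g = "\<lambda>y. a * y + c"] G assms)
      (auto intro!: derivative_eq_intros)
  then have "((\<lambda>y. k * G (a * y + c)) has_real_derivative a * k * G' (a * x + c)) (at x)"
    by (simp add: ac_simps)
  moreover have "open ?U"
    using \<open>open S\<close> by (intro open_vimage continuous_intros)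
  ultimately show "(h has_real_derivative a * k * G' (a * x + c)) (at x)"
    by (rule has_field_derivative_transform_within_open) (use assms in auto)
qed

lemma iterated_D_s_D_t_of_ridge:
  fixes F :: "real \<Rightarrow> real \<Rightarrow> real" and G :: "nat \<Rightarrow> real \<Rightarrow> real"
  assumes S: "open S"
    and G: "\<And>n x. x \<in> S \<Longrightarrow> (G n has_real_derivative G (Suc n) x) (at x)"
    and F: "\<And>s t. a * s + b * t \<in> S \<Longrightarrow> F s t = G 0 (a * s + b * t)"
    and "a * s + b * t \<in> S"
  shows "(D_s ^^ p) ((D_t ^^ q) F) s t = a ^ p * b ^ q * G (p + q) (a * s + b * t)"
proof -
  have D_t_iter: "(D_t ^^ q) F s t = b ^ q * G q (a * s + b * t)"
    if "a * s + b * t \<in> S" for s t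
    using that
  proof (induction q arbitrary: s t)
    case 0
    then show ?case by (simp add: F)
  next
    case (Suc q)
    have "deriv (\<lambda>y. (D_t ^^ q) F s y) t = b * b ^ q * G (Suc q) (b * t + a * s)"
      by (rule deriv_of_ridge [OF S G]) (use Suc in \<open>auto simp: add.commute\<close>)
    then show ?case by (simp add: D_t_def [of "(D_t ^^ q) F"] add.commute)
  qed
  show ?thesis
    using \<open>a * s + b * t \<in> S\<close>
  proof (induction p arbitrary: s t)
    case 0
    then show ?case by (simp add: D_t_iter)
  next
    case (Suc p)
    have "deriv (\<lambda>x. (D_s ^^ p) ((D_t ^^ q) F) x t) s
        = a * (a ^ p * b ^ q) * G (Suc (p + q)) (a * s + b * t)"
      by (rule deriv_of_ridge [OF S G]) (use Suc in auto)
    then show ?case by (simp add: D_s_def [of "(D_s ^^ p) _"] mult.assoc)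
  qed
qed

section \<open>The kernel estimate\<close>

lemma abs_iterated_D_s_D_t_half_csc_le:
  fixes K :: "real \<Rightarrow> real \<Rightarrow> real"
  assumes K: "\<And>s t. a * s + b * t \<in> {0<..<2} \<Longrightarrow> K s t = half_csc_deriv 0 (a * s + b * t)"
    and "\<bar>a\<bar> = 1" "\<bar>b\<bar> = 1"
    and "0 < \<delta>" "\<delta> \<le> a * s + b * t" "\<delta> \<le> 2 - (a * s + b * t)"
  shows "\<bar>(D_s ^^ p) ((D_t ^^ q) K) s t\<bar> \<le> 2 ^ (p + q) * fact (p + q) / \<delta> ^ (p + q + 1)"
proof -
  have "(D_s ^^ p) ((D_t ^^ q) K) s t = a ^ p * b ^ q * half_csc_deriv (p + q) (a * s + b * t)"
    by (rule iterated_D_s_D_t_of_ridge [where S = "{0<..<2}", OF _ half_csc_deriv_has_derivative K])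
      (use assms in auto)
  then have "\<bar>(D_s ^^ p) ((D_t ^^ q) K) s t\<bar> = \<bar>half_csc_deriv (p + q) (a * s + b * t)\<bar>"
    using assms(2,3) by (simp add: abs_mult power_abs)
  then show ?thesis using abs_half_csc_deriv_le assms(4-6) by simp
qed

theorem proposition6p1:
  "\<exists>C d :: real. C > 0 \<and> d > 0 \<and>
     (\<forall>s\<in>{0<..<1}. \<forall>t\<in>{0<..<1}. s \<noteq> t \<longrightarrow>
       (\<forall>p p' :: nat. p \<ge> 1 \<longrightarrow> p' \<ge> 1 \<longrightarrow>
         (\<forall>K\<in>{K_plus, K_minus}.
           \<bar>(D_s ^^ p) ((D_t ^^ p') K) s t\<bar>
             \<le> C * (d ^ (p + p') * fact (p + p') / \<bar>s - t\<bar> ^ (p + p' + 1)))))"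
proof -
  have "\<bar>(D_s ^^ p) ((D_t ^^ p') K) s t\<bar>
      \<le> 2 ^ (p + p') * fact (p + p') / \<bar>s - t\<bar> ^ (p + p' + 1)"
    if st: "s \<in> {0<..<1}" "t \<in> {0<..<1}" "s \<noteq> t" and "K \<in> {K_plus, K_minus}" for s t p p' K
  proof -
    have "s < t \<or> t < s" using st by auto
    then consider "K = K_plus" | "K = K_minus" "s > t" | "K = K_minus" "s < t"
      using \<open>K \<in> {K_plus, K_minus}\<close> by blast
    then show ?thesis
    proof cases
      case 1
      show ?thesis
        by (rule abs_iterated_D_s_D_t_half_csc_le [where a = 1 and b = 1])
          (use 1 st in \<open>auto simp: K_plus_def half_csc_deriv_0\<close>)
    next
      case 2
      show ?thesis
        by (rule abs_iterated_D_s_D_t_half_csc_le [where a = 1 and b = "-1"])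
          (use 2 st in \<open>auto simp: K_minus_def half_csc_deriv_0\<close>)
    next
      case 3
      show ?thesis
        by (rule abs_iterated_D_s_D_t_half_csc_le [where a = "-1" and b = 1])
          (use 3 st in \<open>auto simp: K_minus_def half_csc_deriv_0\<close>)
    qed
  qed
  then show ?thesis
    by (intro exI [of _ 1] exI [of _ 2]) simp
qed

end
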